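(* Consider the Riemann problem at a junction with upstream links $A$ and downstream links $B$ as described in the context. For every solution of the Riemann problem with initial states $(U_a)_{a\in A\cup B}$, $$\theta^0=\theta=\theta^*=\tilde\theta,$$ and for every $a\in A$ $$\tilde\delta_a=\min\{\delta_a,\theta\}=\min\{\delta_a^0,\theta^0\}=\min\{\delta_a^*,\theta^*\}=\min\{\delta_a,\tilde\theta\}.$$ Therefore the local flux function $\mathbb{FF}^0$ is invariant, i.e. the global flux function $\mathbb{FF}$, which maps the initial upstream demands and downstream supplies $(d_1,\dots,d_m,s_{m+1},\dots,s_{m+n})$ to the boundary fluxes $(f_1,\dots,f_{m+n})$ of the solutions of the Riemann problem, is well defined and $\mathbb{FF}=\mathbb{FF}^0$.
   Context: Let $m,n\ge 1$, $A=\{1,\dots,m\}$ (upstream links), $B=\{m+1,\dots,m+n\}$ (downstream links). Each link $a\in A\cup B$ has a capacity $C_a>0$. Turning proportions $\xi_{a\to b}\in(0,1]$ ($a\in A,b\in B$) are given with $\sum_{b\in B}\xi_{a\to b}=1$ for all $a\in A$; write $C_{a\to b}=C_a\xi_{a\to b}>0$. Traffic states. A state on link $a$ is a pair $U=(d,s)$ (demand, supply) with $0\le d,s\le C_a$ and $\max\{d,s\}=C_a$. Local flux function. $\mathbb{FF}^0$ maps $(x_1,\dots,x_m,y_{m+1},\dots,y_{m+n})$ with $x_a\in[0,C_a]$, $y_b\in[0,C_b]$ to $(f_1,\dots,f_{m+n})$, where $f_a=\min\{x_a,tC_a\}$ for $a\in A$, $f_b=\sum_{a\in A}f_a\xi_{a\to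 b}$ for $b\in B$, and $$t=\min\Big\{\max_{a\in A}\frac{x_a}{C_a},\ \min_{b\in B}\max_{\emptyset\ne A_1\subseteq A}\frac{y_b-\sum_{\alpha\in A\setminus A_1}x_\alpha\xi_{\alpha\to b}}{\sum_{a\in A_1}C_a\xi_{a\to b}}\Big\}.$$ Riemann problem. Given initial states $U_a=(d_a,s_a)$, $a\in A\cup B$, a solution consists of stationary states $U_a^*=(d_a^*,s_a^* )$, interior states $U_a^0=(d_a^0,s_a^0)$ and boundary fluxes $f_a$, $a\in A\cup B$, such that: (1) $f_a=\min\{d_a^*,s_a^*\}$ for all $a\in A\cup B$; (2) for $a\in A$: $U_a^*\in\{(d_a,C_a)\}\cup\{(C_a,s):s<d_a\}$; for $b\in B$: $U_b^*\in\{(C_b,s_b)\}\cup\{(d,C_b):d<s_b\}$; (3) for $a\in A$: if $s_a^*<d_a^*=C_a$ then $U_a^0=U_a^*$, and if $d_a^*\le s_a^*=C_a$ then $s_a^0\ge d_a^*$; for $b\in B$: if $d_b^*<s_b^*=C_b$ then $U_b^0=U_b^*$, and if $s_b^*\le d_b^*=C_b$ then $d_b^0\ge s_b^*$; (4) (entropy condition) $(f_1,\dots,f_{m+n})=\mathbb{FF}^0(d_1^0,\dots,d_m^0,s_{m+1}^0,\dots,s_{m+n}^0)$. Notation. For $a\in A$: $\delta_a=d_a/C_a$, $\delta_a^*=d_a^*/C_a$, $\delta_a^0=d_a^0/C_a$, $\tilde\delta_a=f_a/C_a$. For $b\in B$: $\sigma_b=s_b/C_b$, $\sigma_b^*=s_b^*/C_b$,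 $\sigma_b^0=s_b^0/C_b$. For $\mu=(\mu_a)_{a\in A}\in[0,1]^A$, $\nu=(\nu_b)_{b\in B}\in[0,1]^B$ put $$g(\mu,\nu)=\min_{b\in B}\max_{\emptyset\ne A_1\subseteq A}\frac{C_b\nu_b-\sum_{\alpha\in A\setminus A_1}C_{\alpha\to b}\mu_\alpha}{\sum_{a\in A_1}C_{a\to b}}.$$ Then $\theta^0=\min\{\max_a\delta_a^0,g(\delta^0,\sigma^0)\}$, $\theta=\min\{\max_a\delta_a,g(\delta,\sigma)\}$, $\theta^*=\min\{\max_a\delta_a^*,g(\delta^*,\sigma^* )\}$, $\tilde\theta=\min\{\max_a\tilde\delta_a,g(\tilde\delta,\sigma)\}$. *)

theory Defs
  imports Complex_Main "HOL-Library.FuncSet"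
begin

text \<open>
  Links are numbered: \<open>{1..m}\<close> are upstream, \<open>{m+1..m+n}\<close> are downstream. A vector indexed by the
  links is a function on \<open>nat\<close> of which only the values on \<open>{1..m+n}\<close> are relevant; flux vectors
  are normalized to be \<open>extensional {1..m+n}\<close>, so that their equality is equality of tuples.
\<close>

abbreviation upstream :: "nat \<Rightarrow> nat set"
  where "upstream m \<equiv> {1..m}"

abbreviation downstream :: "nat \<Rightarrow> nat \<Rightarrow> nat set"
  where "downstream m n \<equiv> {m+1..m+n}"

abbreviation links :: "nat \<Rightarrow> nat \<Rightarrow> nat set"
  where "links m n \<equiv> upstream m \<union> downstream m n"

text \<open>A state of a link of capacity \<open>c\<close> is a pair (demand, supply).\<close>

definition states :: "real \<Rightarrow> (real \<times> real) set"
  where "states c = {(d, s). 0 \<le> d \<and> d \<le> c \<and> 0 \<le> s \<and> s \<le> c \<and> max d s = c}"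

definition link_states :: "nat \<Rightarrow> nat \<Rightarrow> (nat \<Rightarrow> real) \<Rightarrow> (nat \<Rightarrow> real \<times> real) set"
  where "link_states m n C = {U. \<forall>a\<in>links m n. U a \<in> states (C a)}"

abbreviation demand_of :: "(nat \<Rightarrow> real \<times> real) \<Rightarrow> nat \<Rightarrow> real"
  where "demand_of U a \<equiv> fst (U a)"

abbreviation supply_of :: "(nat \<Rightarrow> real \<times> real) \<Rightarrow> nat \<Rightarrow> real"
  where "supply_of U a \<equiv> snd (U a)"

text \<open>The vector \<open>(d\<^sub>1,\<dots>,d\<^sub>m,s\<^sub>m\<^sub>+\<^sub>1,\<dots>,s\<^sub>m\<^sub>+\<^sub>n)\<close>.\<close>

definition junction_data :: "nat \<Rightarrow> (nat \<Rightarrow> real \<times> real) \<Rightarrow> nat \<Rightarrow> real"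
  where "junction_data m U = (\<lambda>a. if a \<in> upstream m then demand_of U a else supply_of U a)"

text \<open>In the following \<open>z = (x\<^sub>1,\<dots>,x\<^sub>m,y\<^sub>m\<^sub>+\<^sub>1,\<dots>,y\<^sub>m\<^sub>+\<^sub>n)\<close>.\<close>

definition critical_level ::
  "nat \<Rightarrow> nat \<Rightarrow> (nat \<Rightarrow> real) \<Rightarrow> (nat \<Rightarrow> nat \<Rightarrow> real) \<Rightarrow> (nat \<Rightarrow> real) \<Rightarrow> real"
  where "critical_level m n C \<xi> z =
    min (MAX a\<in>upstream m. z a / C a)
        (MIN b\<in>downstream m n. MAX A1\<in>{A1. A1 \<noteq> {} \<and> A1 \<subseteq> upstream m}.
           (z b - (\<Sum>\<alpha>\<in>upstream m - A1. z \<alpha> * \<xi> \<alpha> b)) / (\<Sum>a\<in>A1. C a * \<xi> a b))"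

definition local_flux ::
  "nat \<Rightarrow> nat \<Rightarrow> (nat \<Rightarrow> real) \<Rightarrow> (nat \<Rightarrow> nat \<Rightarrow> real) \<Rightarrow> (nat \<Rightarrow> real) \<Rightarrow> nat \<Rightarrow> real"
  where "local_flux m n C \<xi> z =
    (let t = critical_level m n C \<xi> z; \<phi> = (\<lambda>a. min (z a) (t * C a))
     in restrict (\<lambda>a. if a \<in> upstream m then \<phi> a else (\<Sum>\<alpha>\<in>upstream m. \<phi> \<alpha> * \<xi> \<alpha> a))
          (links m n))"

text \<open>\<open>Us\<close> are the stationary and \<open>U0\<close> the interior states, \<open>f\<close> the boundary fluxes.\<close>

definition riemann_solution ::
  "nat \<Rightarrow> nat \<Rightarrow> (nat \<Rightarrow> real) \<Rightarrow> (nat \<Rightarrow> nat \<Rightarrow> real) \<Rightarrow> (nat \<Rightarrow> real \<times> real) \<Rightarrow>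
   (nat \<Rightarrow> real \<times> real) \<Rightarrow> (nat \<Rightarrow> real \<times> real) \<Rightarrow> (nat \<Rightarrow> real) \<Rightarrow> bool"
  where "riemann_solution m n C \<xi> U Us U0 f \<longleftrightarrow>
    Us \<in> link_states m n C \<and> U0 \<in> link_states m n C \<and> f \<in> extensional (links m n) \<and>
    (\<forall>a\<in>links m n. f a = min (demand_of Us a) (supply_of Us a)) \<and>
    (\<forall>a\<in>upstream m. Us a \<in> {(demand_of U a, C a)} \<union> {(C a, s) | s. s < demand_of U a}) \<and>
    (\<forall>b\<in>downstream m n. Us b \<in> {(C b, supply_of U b)} \<union> {(d, C b) | d. d < supply_of U b}) \<and>
    (\<forall>a\<in>upstream m.
       (supply_of Us a < demand_of Us a \<and> demand_of Us a = C a \<longrightarrow> U0 a = Us a) \<and>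
       (demand_of Us a \<le> supply_of Us a \<and> supply_of Us a = C a \<longrightarrow> supply_of U0 a \<ge> demand_of Us a)) \<and>
    (\<forall>b\<in>downstream m n.
       (demand_of Us b < supply_of Us b \<and> supply_of Us b = C b \<longrightarrow> U0 b = Us b) \<and>
       (supply_of Us b \<le> demand_of Us b \<and> demand_of Us b = C b \<longrightarrow> demand_of U0 b \<ge> supply_of Us b)) \<and>
    f = local_flux m n C \<xi> (junction_data m U0)"

text \<open>\<open>f\<close> is the flux vector of some solution for some initial states whose upstream demands and
  downstream supplies are \<open>z\<close>; the global flux function is meaningful only
  where this relation has exactly one value.\<close>

definition riemann_flux ::
  "nat \<Rightarrow> nat \<Rightarrow> (nat \<Rightarrow> real) \<Rightarrow> (nat \<Rightarrow> nat \<Rightarrow> real) \<Rightarrow> (nat \<Rightarrow> real) \<Rightarrow> (nat \<Rightarrow> real) \<Rightarrow> bool"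
  where "riemann_flux m n C \<xi> z f \<longleftrightarrow>
    (\<exists>U Us U0. U \<in> link_states m n C \<and> (\<forall>a\<in>links m n. junction_data m U a = z a) \<and>
       riemann_solution m n C \<xi> U Us U0 f)"

definition global_flux ::
  "nat \<Rightarrow> nat \<Rightarrow> (nat \<Rightarrow> real) \<Rightarrow> (nat \<Rightarrow> nat \<Rightarrow> real) \<Rightarrow> (nat \<Rightarrow> real) \<Rightarrow> nat \<Rightarrow> real"
  where "global_flux m n C \<xi> z = (THE f. riemann_flux m n C \<xi> z f)"

text \<open>\<open>supply_ratio\<close> is \<open>g(\<mu>,\<nu>)\<close>; \<open>critical_ratio\<close> yields the four values \<open>\<theta>\<close>. It is
  \<open>critical_level\<close> expressed in the normalized quantities \<open>\<mu>\<^sub>a = x\<^sub>a / C\<^sub>a\<close>, \<open>\<nu>\<^sub>b = y\<^sub>b / C\<^sub>b\<close>.\<close>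

definition supply_ratio ::
  "nat \<Rightarrow> nat \<Rightarrow> (nat \<Rightarrow> real) \<Rightarrow> (nat \<Rightarrow> nat \<Rightarrow> real) \<Rightarrow> (nat \<Rightarrow> real) \<Rightarrow> (nat \<Rightarrow> real) \<Rightarrow> real"
  where "supply_ratio m n C \<xi> \<mu> \<nu> =
    (MIN b\<in>downstream m n. MAX A1\<in>{A1. A1 \<noteq> {} \<and> A1 \<subseteq> upstream m}.
       (C b * \<nu> b - (\<Sum>\<alpha>\<in>upstream m - A1. C \<alpha> * \<xi> \<alpha> b * \<mu> \<alpha>)) / (\<Sum>a\<in>A1. C a * \<xi> a b))"

definition critical_ratio ::
  "nat \<Rightarrow> nat \<Rightarrow> (nat \<Rightarrow> real) \<Rightarrow> (nat \<Rightarrow> nat \<Rightarrow> real) \<Rightarrow> (nat \<Rightarrow> real) \<Rightarrow> (nat \<Rightarrow> real) \<Rightarrow> real"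
  where "critical_ratio m n C \<xi> \<mu> \<nu> =
    min (MAX a\<in>upstream m. \<mu> a) (supply_ratio m n C \<xi> \<mu> \<nu>)"

end

theory Submission
  imports Defs
begin

text \<open>
  The local flux function lets every upstream link send \<open>C\<^sub>a min {\<mu>\<^sub>a, t}\<close>, where the common level
  \<open>t\<close> is given by a min-max formula. The formula hides a simple description: \<open>t\<close> is the largest
  level that is at most the greatest demand ratio and whose induced inflow respects every
  downstream supply (lemma \<open>le_critical_ratio_iff\<close>). The inflow is continuous in the level, and
  strictly increasing as long as some demand ratio lies above the level. So the level is
  characterized by a complementarity condition that involves the level only through the fluxes
  and through comparisons with the demand ratios: some link demands at least \<open>t\<close>, no supply is exceeded, and either all links are fully served or
  some supply is exhausted (lemmas \<open>critical_critical_ratio\<close> and \<open>critical_ratio_eqI\<close>).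

  A solution of the Riemann problem provides such fluxes \<open>f\<close> and the level \<open>\<theta>\<^sup>0\<close> belonging to the
  interior states. The admissible stationary states leave two cases on each link. An upstream link
  either sends its whole initial demand, or it is congested, and then its interior demand is the
  capacity although its flux is smaller, so that it sends exactly \<open>\<theta>\<^sup>0 C\<^sub>a\<close>, which is less than its initial demand. A downstream
  link either receives its whole initial supply, or it receives less, and then its interior supply
  is the capacity and cannot be exhausted. In all cases the upstream fluxes equal
  \<open>C\<^sub>a min {\<mu>\<^sub>a, \<theta>\<^sup>0}\<close> for each of the four choices of \<open>\<mu>\<close>; and since \<open>f\<close> serves all interior demands
  or exhausts an interior supply, it does the same for the other data.
  Hence \<open>\<theta>\<^sup>0\<close> satisfies the complementarity condition for all four pairs, and the four levels
  agree (lemma \<open>riemann_solution_levels\<close>).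

  Conversely the fluxes that the local flux function assigns to the initial data satisfy all the
  conditions of a solution when the interior states are taken equal to the stationary ones
  (lemma \<open>riemann_solution_exists\<close>). Thus the fluxes exist, are unique, and are those of the
  local flux function.
\<close>

section \<open>The critical level as a complementarity condition\<close>

locale junction =
  fixes m n :: nat and C :: "nat \<Rightarrow> real" and \<xi> :: "nat \<Rightarrow> nat \<Rightarrow> real"
  assumes upstream_nonempty: "m \<ge> 1" and downstream_nonempty: "n \<ge> 1"
    and capacity_pos: "a \<in> links m n \<Longrightarrow> C a > 0"
    and turning_pos: "a \<in> upstream m \<Longrightarrow> b \<in> downstream m n \<Longrightarrow> 0 < \<xi> a b"
begin

definition inflow :: "(nat \<Rightarrow> real) \<Rightarrow> real \<Rightarrow> nat \<Rightarrow> real"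
  where "inflow \<mu> t b = (\<Sum>a\<in>upstream m. C a * \<xi> a b * min (\<mu> a) t)"

definition critical :: "(nat \<Rightarrow> real) \<Rightarrow> (nat \<Rightarrow> real) \<Rightarrow> real \<Rightarrow> bool"
  where "critical \<mu> \<nu> t \<longleftrightarrow>
    (\<exists>a\<in>upstream m. t \<le> \<mu> a) \<and>
    (\<forall>b\<in>downstream m n. inflow \<mu> t b \<le> C b * \<nu> b) \<and>
    ((\<forall>a\<in>upstream m. \<mu> a \<le> t) \<or> (\<exists>b\<in>downstream m n. inflow \<mu> t b = C b * \<nu> b))"

lemma weight_pos:
  assumes "a \<in> upstream m" and "b \<in> downstream m n"
  shows "0 < C a * \<xi> a b"
  using assms capacity_pos turning_pos by simp

text \<open>Splitting the upstream links into a set \<open>A1\<close> limited by the level and a remainder served in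
  full overestimates the inflow, whatever \<open>A1\<close> is; it is exact when \<open>A1\<close> consists of the links
  with demand ratio at least \<open>t\<close>. That set is nonempty exactly when \<open>t\<close> is at most some demand
  ratio, and then some admissible \<open>A1\<close> attains the inflow.\<close>

lemma le_Max_subsets_iff:
  assumes b: "b \<in> downstream m n" and ex: "\<exists>a\<in>upstream m. t \<le> \<mu> a"
  shows "t \<le> (MAX A1\<in>{A1. A1 \<noteq> {} \<and> A1 \<subseteq> upstream m}.
      (y - (\<Sum>\<alpha>\<in>upstream m - A1. C \<alpha> * \<xi> \<alpha> b * \<mu> \<alpha>)) / (\<Sum>a\<in>A1. C a * \<xi> a b))
    \<longleftrightarrow> inflow \<mu> t b \<le> y"
    (is "t \<le> Max (?q ` ?S) \<longleftrightarrow> _")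
proof -
  have fin: "finite ?S"
    by (rule finite_subset[of _ "Pow (upstream m)"]) auto
  have ne: "upstream m \<in> ?S"
    using upstream_nonempty by auto
  have le_q: "t \<le> ?q A1 \<longleftrightarrow>
      (\<Sum>a\<in>A1. C a * \<xi> a b * t) + (\<Sum>\<alpha>\<in>upstream m - A1. C \<alpha> * \<xi> \<alpha> b * \<mu> \<alpha>) \<le> y"
    if "A1 \<in> ?S" for A1
  proof -
    have "finite A1"
      using that finite_subset by blast
    then have "0 < (\<Sum>a\<in>A1. C a * \<xi> a b)"
      using that b by (intro sum_pos) (auto intro!: weight_pos)
    then show ?thesis
      unfolding sum_distrib_right[symmetric] by (simp add: pos_le_divide_eq le_diff_eq mult.commute)
  qed
  have split: "inflow \<mu> t b = (\<Sum>a\<in>A1. C a * \<xi> a b * min (\<mu> a) t)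
      + (\<Sum>a\<in>upstream m - A1. C a * \<xi> a b * min (\<mu> a) t)"
    if "A1 \<subseteq> upstream m" for A1
    unfolding inflow_def using sum.subset_diff[OF that] by (simp add: add.commute)
  have "(\<exists>A1\<in>?S. t \<le> ?q A1) \<longleftrightarrow> inflow \<mu> t b \<le> y"
  proof
    assume "\<exists>A1\<in>?S. t \<le> ?q A1"
    then obtain A1 where A1: "A1 \<in> ?S" and "t \<le> ?q A1"
      by blast
    then have le: "(\<Sum>a\<in>A1. C a * \<xi> a b * t)
        + (\<Sum>\<alpha>\<in>upstream m - A1. C \<alpha> * \<xi> \<alpha> b * \<mu> \<alpha>) \<le> y"
      using le_q by blast
    have "(\<Sum>a\<in>A1. C a * \<xi> a b * min (\<mu> a) t) \<le> (\<Sum>a\<in>A1. C a * \<xi> a b * t)"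
      using A1 b by (intro sum_mono mult_left_mono less_imp_le[OF weight_pos]) auto
    moreover have "(\<Sum>a\<in>upstream m - A1. C a * \<xi> a b * min (\<mu> a) t)
        \<le> (\<Sum>a\<in>upstream m - A1. C a * \<xi> a b * \<mu> a)"
      using b by (intro sum_mono mult_left_mono less_imp_le[OF weight_pos]) auto
    ultimately show "inflow \<mu> t b \<le> y"
      using le split[of A1] A1 by simp
  next
    assume le: "inflow \<mu> t b \<le> y"
    let ?A1 = "{a \<in> upstream m. t \<le> \<mu> a}"
    have A1: "?A1 \<in> ?S"
      using ex by auto
    have "inflow \<mu> t b = (\<Sum>a\<in>?A1. C a * \<xi> a b * t)
        + (\<Sum>a\<in>upstream m - ?A1. C a * \<xi> a b * \<mu> a)"
      using A1 by (subst split[of ?A1])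
        (auto intro!: arg_cong2[where f = "(+)"] sum.cong simp: min_def)
    then have "t \<le> ?q ?A1"
      using le le_q[OF A1] by simp
    then show "\<exists>A1\<in>?S. t \<le> ?q A1"
      using A1 by blast
  qed
  moreover have "t \<le> Max (?q ` ?S) \<longleftrightarrow> (\<exists>A1\<in>?S. t \<le> ?q A1)"
    using fin ne by (subst Max_ge_iff) auto
  ultimately show ?thesis
    by simp
qed

text \<open>The min-max formula as the largest feasible level.\<close>

lemma le_critical_ratio_iff:
  "t \<le> critical_ratio m n C \<xi> \<mu> \<nu> \<longleftrightarrow>
    (\<exists>a\<in>upstream m. t \<le> \<mu> a) \<and> (\<forall>b\<in>downstream m n. inflow \<mu> t b \<le> C b * \<nu> b)"
proof -
  have "t \<le> (MAX a\<in>upstream m. \<mu> a) \<longleftrightarrow> (\<exists>a\<in>upstream m. t \<le> \<mu> a)"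
    using upstream_nonempty by (subst Max_ge_iff) auto
  moreover have "t \<le> supply_ratio m n C \<xi> \<mu> \<nu> \<longleftrightarrow>
      (\<forall>b\<in>downstream m n. inflow \<mu> t b \<le> C b * \<nu> b)"
    if "\<exists>a\<in>upstream m. t \<le> \<mu> a"
    unfolding supply_ratio_def using downstream_nonempty
    by (subst Min_ge_iff)
      (simp, simp, simp only: ball_simps le_Max_subsets_iff[OF _ that] cong: ball_cong)
  ultimately show ?thesis
    unfolding critical_ratio_def by auto
qed

lemma inflow_strict_mono:
  assumes "b \<in> downstream m n" and "t < s" and "\<exists>a\<in>upstream m. s \<le> \<mu> a"
  shows "inflow \<mu> t b < inflow \<mu> s b"
  unfolding inflow_def
proof (rule sum_strict_mono_ex1)
  show "\<forall>a\<in>upstream m. C a * \<xi> a b * min (\<mu> a) t \<le> C a * \<xi> a b * min (\<mu> a) s"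
    using assms by (intro ballI mult_left_mono less_imp_le[OF weight_pos]) auto
  obtain a where "a \<in> upstream m" "s \<le> \<mu> a"
    using assms(3) by blast
  with \<open>t < s\<close> show "\<exists>a\<in>upstream m. C a * \<xi> a b * min (\<mu> a) t < C a * \<xi> a b * min (\<mu> a) s"
    using assms(1) by (intro bexI[of _ a] mult_strict_left_mono weight_pos) auto
qed simp

text \<open>If some link were not fully served and no supply exhausted, then by continuity of the inflow
  the level could be raised a little.\<close>

lemma critical_critical_ratio: "critical \<mu> \<nu> (critical_ratio m n C \<xi> \<mu> \<nu>)"
proof -
  define t where "t = critical_ratio m n C \<xi> \<mu> \<nu>"
  have feasible: "\<exists>a\<in>upstream m. t \<le> \<mu> a" "\<forall>b\<in>downstream m n. inflow \<mu> t b \<le> C b * \<nu> b"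
    using le_critical_ratio_iff[of t \<mu> \<nu>] t_def by auto
  have "(\<forall>a\<in>upstream m. \<mu> a \<le> t) \<or> (\<exists>b\<in>downstream m n. inflow \<mu> t b = C b * \<nu> b)"
  proof (rule ccontr)
    assume "\<not> ?thesis"
    then obtain a where a: "a \<in> upstream m" "t < \<mu> a"
      and slack: "\<forall>b\<in>downstream m n. inflow \<mu> t b < C b * \<nu> b"
      using feasible(2) by (force simp: not_le)
    have "((\<lambda>s. inflow \<mu> s b) \<longlongrightarrow> inflow \<mu> t b) (at_right t)" for b
      unfolding inflow_def by (intro tendsto_intros)
    then have "eventually (\<lambda>s. inflow \<mu> s b < C b * \<nu> b) (at_right t)"
      if "b \<in> downstream m n" for b
      using slack that order_tendstoD(2) by blast
    then have "eventually (\<lambda>s. \<forall>b\<in>downstream m n. inflow \<mu> s b < C b * \<nu> b) (at_right t)"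
      by (simp add: eventually_ball_finite)
    moreover have "eventually (\<lambda>s. t < s \<and> s < \<mu> a) (at_right t)"
      using a(2) by (auto simp: eventually_at_right_field)
    ultimately have "eventually (\<lambda>s. (\<forall>b\<in>downstream m n. inflow \<mu> s b < C b * \<nu> b)
        \<and> t < s \<and> s < \<mu> a) (at_right t)"
      by (rule eventually_conj)
    then obtain s where "\<forall>b\<in>downstream m n. inflow \<mu> s b < C b * \<nu> b" "t < s" "s < \<mu> a"
      using eventually_happens'[OF trivial_limit_at_right_real] by blast
    then have "s \<le> t"
      unfolding t_def using a(1) by (force simp: le_critical_ratio_iff)
    with \<open>t < s\<close> show False
      by simp
  qed
  with feasible show ?thesis
    unfolding critical_def t_def by simp
qed

text \<open>Uniqueness: at any higher level that some link still demands, the inflow into an exhausted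
  link would exceed its supply.\<close>

lemma critical_imp_eq:
  assumes "critical \<mu> \<nu> t"
  shows "critical_ratio m n C \<xi> \<mu> \<nu> = t"
proof (rule antisym)
  show "t \<le> critical_ratio m n C \<xi> \<mu> \<nu>"
    using assms by (simp add: critical_def le_critical_ratio_iff)
  show "critical_ratio m n C \<xi> \<mu> \<nu> \<le> t"
  proof (rule ccontr)
    assume "\<not> ?thesis"
    then have less: "t < critical_ratio m n C \<xi> \<mu> \<nu>" (is "t < ?s")
      by simp
    have ex: "\<exists>a\<in>upstream m. ?s \<le> \<mu> a"
      and fits: "\<forall>b\<in>downstream m n. inflow \<mu> ?s b \<le> C b * \<nu> b"
      using le_critical_ratio_iff[of ?s \<mu> \<nu>] by auto
    have "\<not> (\<forall>a\<in>upstream m. \<mu> a \<le> t)"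
      using ex less by force
    then obtain b where "b \<in> downstream m n" "inflow \<mu> t b = C b * \<nu> b"
      using assms unfolding critical_def by blast
    then show False
      using inflow_strict_mono[OF _ less ex] fits by force
  qed
qed

text \<open>In terms of fluxes that are demand ratios truncated at the level, the condition involves
  the level only by comparison with the demand ratios. In this form it carries over between different data
  that share one flux vector.\<close>

lemma critical_flux_iff:
  assumes flux: "\<And>a. a \<in> upstream m \<Longrightarrow> f a / C a = min (\<mu> a) t"
    and split: "\<And>b. b \<in> downstream m n \<Longrightarrow> f b = (\<Sum>a\<in>upstream m. f a * \<xi> a b)"
  shows "critical \<mu> (\<lambda>b. y b / C b) t \<longleftrightarrow>
    (\<exists>a\<in>upstream m. t \<le> \<mu> a) \<and> (\<forall>b\<in>downstream m n. f b \<le> y b) \<and>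
    ((\<forall>a\<in>upstream m. \<mu> a \<le> t) \<or> (\<exists>b\<in>downstream m n. f b = y b))"
proof -
  have inflow: "inflow \<mu> t b = f b" if "b \<in> downstream m n" for b
    unfolding inflow_def split[OF that]
  proof (rule sum.cong)
    fix a assume a: "a \<in> upstream m"
    then have "C a \<noteq> 0"
      using capacity_pos[of a] by simp
    then show "C a * \<xi> a b * min (\<mu> a) t = f a * \<xi> a b"
      by (simp add: flux[OF a, symmetric])
  qed simp
  have supply_eq: "C b * (y b / C b) = y b" if "b \<in> downstream m n" for b
    using that capacity_pos[of b] by simp
  show ?thesis
    unfolding critical_def by (simp only: inflow supply_eq cong: ball_cong bex_cong)
qed

lemma critical_ratio_eqI:
  assumes "\<And>a. a \<in> upstream m \<Longrightarrow> f a / C a = min (\<mu> a) t"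
    and "\<And>b. b \<in> downstream m n \<Longrightarrow> f b = (\<Sum>a\<in>upstream m. f a * \<xi> a b)"
    and "\<exists>a\<in>upstream m. t \<le> \<mu> a"
    and "\<And>b. b \<in> downstream m n \<Longrightarrow> f b \<le> y b"
    and "(\<forall>a\<in>upstream m. \<mu> a \<le> t) \<or> (\<exists>b\<in>downstream m n. f b = y b)"
  shows "critical_ratio m n C \<xi> \<mu> (\<lambda>b. y b / C b) = t"
  using assms(3-5) critical_flux_iff[OF assms(1,2), where y = y]
  by (intro critical_imp_eq) blast

lemma critical_ratio_nonneg:
  assumes "\<And>a. a \<in> upstream m \<Longrightarrow> 0 \<le> \<mu> a" and "\<And>b. b \<in> downstream m n \<Longrightarrow> 0 \<le> \<nu> b"
  shows "0 \<le> critical_ratio m n C \<xi> \<mu> \<nu>"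
  unfolding le_critical_ratio_iff
proof
  show "\<exists>a\<in>upstream m. 0 \<le> \<mu> a"
    using assms(1) upstream_nonempty by (intro bexI[of _ 1]) auto
  show "\<forall>b\<in>downstream m n. inflow \<mu> 0 b \<le> C b * \<nu> b"
    using assms capacity_pos by (auto simp: inflow_def min_absorb2 less_imp_le)
qed


section \<open>The local flux function\<close>

lemma critical_ratio_cong:
  assumes "\<And>a. a \<in> upstream m \<Longrightarrow> \<mu> a = \<mu>' a" and "\<And>b. b \<in> downstream m n \<Longrightarrow> \<nu> b = \<nu>' b"
  shows "critical_ratio m n C \<xi> \<mu> \<nu> = critical_ratio m n C \<xi> \<mu>' \<nu>'"
proof (rule critical_imp_eq)
  have "inflow \<mu> t b = inflow \<mu>' t b" for t b
    unfolding inflow_def using assms(1) by (intro sum.cong) auto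
  then show "critical \<mu> \<nu> (critical_ratio m n C \<xi> \<mu>' \<nu>')"
    using critical_critical_ratio[of \<mu>' \<nu>'] assms by (simp add: critical_def)
qed

abbreviation level :: "(nat \<Rightarrow> real) \<Rightarrow> real"
  where "level z \<equiv> critical_ratio m n C \<xi> (\<lambda>a. z a / C a) (\<lambda>b. z b / C b)"

lemma critical_level_eq_level: "critical_level m n C \<xi> z = level z"
proof -
  have "(\<Sum>\<alpha>\<in>upstream m - A1. z \<alpha> * \<xi> \<alpha> b)
      = (\<Sum>\<alpha>\<in>upstream m - A1. C \<alpha> * \<xi> \<alpha> b * (z \<alpha> / C \<alpha>))" for A1 b
  proof (rule sum.cong)
    fix \<alpha> assume "\<alpha> \<in> upstream m - A1"
    then have "C \<alpha> \<noteq> 0"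
      using capacity_pos[of \<alpha>] by simp
    then show "z \<alpha> * \<xi> \<alpha> b = C \<alpha> * \<xi> \<alpha> b * (z \<alpha> / C \<alpha>)"
      by simp
  qed simp
  moreover have "C b * (z b / C b) = z b" if "b \<in> downstream m n" for b
    using capacity_pos that by fastforce
  ultimately show ?thesis
    unfolding critical_level_def critical_ratio_def supply_ratio_def
    by (simp only: cong: image_cong)
qed

lemma level_junction_data:
  "level (junction_data m V)
    = critical_ratio m n C \<xi> (\<lambda>a. demand_of V a / C a) (\<lambda>b. supply_of V b / C b)"
  by (rule critical_ratio_cong) (auto simp: junction_data_def)

lemma local_flux_upstream:
  assumes "a \<in> upstream m"
  shows "local_flux m n C \<xi> z a / C a = min (z a / C a) (level z)"
proof -
  have "0 < C a"
    using assms capacity_pos by simp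
  then show ?thesis
    using assms by (simp add: local_flux_def Let_def critical_level_eq_level min_divide_distrib_right)
qed

lemma local_flux_downstream:
  assumes "b \<in> downstream m n"
  shows "local_flux m n C \<xi> z b = (\<Sum>a\<in>upstream m. local_flux m n C \<xi> z a * \<xi> a b)"
  using assms by (auto simp: local_flux_def Let_def intro!: sum.cong)

lemma local_flux_eqI:
  assumes "f \<in> extensional (links m n)"
    and "\<And>a. a \<in> upstream m \<Longrightarrow> f a / C a = min (z a / C a) (level z)"
    and "\<And>b. b \<in> downstream m n \<Longrightarrow> f b = (\<Sum>a\<in>upstream m. f a * \<xi> a b)"
  shows "f = local_flux m n C \<xi> z"
proof (rule extensionalityI[OF assms(1)])
  show "local_flux m n C \<xi> z \<in> extensional (links m n)"
    by (simp add: local_flux_def Let_def)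
  have up: "f a = local_flux m n C \<xi> z a" if "a \<in> upstream m" for a
  proof -
    have "C a \<noteq> 0"
      using that capacity_pos[of a] by simp
    then show ?thesis
      using assms(2)[OF that] local_flux_upstream[OF that, of z] by (simp add: divide_eq_eq)
  qed
  then have "f b = local_flux m n C \<xi> z b" if "b \<in> downstream m n" for b
    unfolding assms(3)[OF that] local_flux_downstream[OF that] by (intro sum.cong) auto
  with up show "f a = local_flux m n C \<xi> z a" if "a \<in> links m n" for a
    using that by blast
qed


section \<open>Solutions of the Riemann problem\<close>

lemma link_statesD:
  assumes "V \<in> link_states m n C" and "a \<in> links m n"
  shows "0 \<le> demand_of V a" "demand_of V a \<le> C a" "0 \<le> supply_of V a" "supply_of V a \<le> C a"
proof -
  have "V a \<in> states (C a)"
    using assms unfolding link_states_def by blast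
  then show "0 \<le> demand_of V a" "demand_of V a \<le> C a" "0 \<le> supply_of V a" "supply_of V a \<le> C a"
    by (auto simp: states_def case_prod_unfold)
qed

text \<open>By \<open>critical_ratio_eqI\<close> it suffices that truncating each
  of the demand vectors at the interior level gives the fluxes, and that the alternative "all
  served or some supply exhausted" is inherited from the interior data.\<close>

lemma riemann_solution_levels:
  assumes U: "U \<in> link_states m n C" and sol: "riemann_solution m n C \<xi> U Us U0 f"
  defines "\<theta> \<equiv> critical_ratio m n C \<xi> (\<lambda>a. demand_of U0 a / C a) (\<lambda>b. supply_of U0 b / C b)"
  shows "critical_ratio m n C \<xi> (\<lambda>a. demand_of U a / C a) (\<lambda>b. supply_of U b / C b) = \<theta>"
    and "critical_ratio m n C \<xi> (\<lambda>a. demand_of Us a / C a) (\<lambda>b. supply_of Us b / C b) = \<theta>"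
    and "critical_ratio m n C \<xi> (\<lambda>a. f a / C a) (\<lambda>b. supply_of U b / C b) = \<theta>"
    and "\<And>a. a \<in> upstream m \<Longrightarrow> f a / C a = min (demand_of U0 a / C a) \<theta>"
    and "\<And>a. a \<in> upstream m \<Longrightarrow> f a / C a = min (demand_of U a / C a) \<theta>"
    and "\<And>a. a \<in> upstream m \<Longrightarrow> f a / C a = min (demand_of Us a / C a) \<theta>"
    and "\<And>b. b \<in> downstream m n \<Longrightarrow> f b = (\<Sum>a\<in>upstream m. f a * \<xi> a b)"
proof -
  have Us: "Us \<in> link_states m n C" and U0: "U0 \<in> link_states m n C"
    and f_min: "\<And>a. a \<in> links m n \<Longrightarrow> f a = min (demand_of Us a) (supply_of Us a)"
    and up: "\<And>a. a \<in> upstream m \<Longrightarrow>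
      Us a = (demand_of U a, C a) \<or> (\<exists>s<demand_of U a. Us a = (C a, s))"
    and down: "\<And>b. b \<in> downstream m n \<Longrightarrow>
      Us b = (C b, supply_of U b) \<or> (\<exists>d<supply_of U b. Us b = (d, C b))"
    and up0: "\<And>a. a \<in> upstream m \<Longrightarrow> supply_of Us a < demand_of Us a \<Longrightarrow>
      demand_of Us a = C a \<Longrightarrow> U0 a = Us a"
    and down0: "\<And>b. b \<in> downstream m n \<Longrightarrow> demand_of Us b < supply_of Us b \<Longrightarrow>
      supply_of Us b = C b \<Longrightarrow> U0 b = Us b"
    and f_local: "f = local_flux m n C \<xi> (junction_data m U0)"
    using sol unfolding riemann_solution_def by auto
  have \<theta>_level: "level (junction_data m U0) = \<theta>"
    unfolding \<theta>_def by (rule level_junction_data)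
  show split: "\<And>b. b \<in> downstream m n \<Longrightarrow> f b = (\<Sum>a\<in>upstream m. f a * \<xi> a b)"
    unfolding f_local by (rule local_flux_downstream)
  show f0: "f a / C a = min (demand_of U0 a / C a) \<theta>" if "a \<in> upstream m" for a
    using local_flux_upstream[OF that, of "junction_data m U0"] that
    unfolding \<theta>_level f_local[symmetric] by (simp add: junction_data_def)

  have up_cases: "(f a = demand_of U a \<and> demand_of Us a = demand_of U a) \<or>
      (f a < demand_of U a \<and> demand_of Us a = C a \<and> demand_of U0 a = C a)"
    if "a \<in> upstream m" for a
    using up[OF that] link_statesD(2)[OF U, of a] that f_min[of a] up0[OF that] by force
  have down_cases: "(f b = supply_of U b \<and> supply_of Us b = supply_of U b) \<or>
      (f b < supply_of U b \<and> supply_of Us b = C b \<and> supply_of U0 b = C b)"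
    if "b \<in> downstream m n" for b
    using down[OF that] link_statesD(4)[OF U, of b] that f_min[of b] down0[OF that] by force

  \<comment> \<open>On a congested link the interior demand ratio is one, and the flux is below the capacity;
    so the flux ratio is the level itself.\<close>
  have up_ratios: "(f a / C a = demand_of U a / C a \<and> demand_of Us a / C a = demand_of U a / C a) \<or>
      (f a / C a = \<theta> \<and> \<theta> < 1 \<and> \<theta> < demand_of U a / C a \<and> demand_of Us a / C a = 1
        \<and> demand_of U0 a / C a = 1)"
    if a: "a \<in> upstream m" for a
  proof -
    have pos: "0 < C a"
      using a capacity_pos by simp
    consider "f a = demand_of U a" "demand_of Us a = demand_of U a"
      | "f a < demand_of U a" "demand_of Us a = C a" "demand_of U0 a = C a"
      using up_cases[OF a] by blast
    then show ?thesis
    proof cases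
      case 2
      have "f a / C a < demand_of U a / C a" "demand_of U a / C a \<le> 1"
        using 2 pos link_statesD(2)[OF U, of a] a by (auto simp: divide_strict_right_mono)
      moreover have "f a / C a = min 1 \<theta>"
        using f0[OF a] 2 pos by simp
      ultimately show ?thesis
        using 2 pos by (auto simp: min_def split: if_splits)
    qed simp
  qed

  show f_init: "f a / C a = min (demand_of U a / C a) \<theta>" if "a \<in> upstream m" for a
    using up_ratios[OF that] f0[OF that] by (auto simp: min_def split: if_splits)
  show f_stat: "f a / C a = min (demand_of Us a / C a) \<theta>" if "a \<in> upstream m" for a
    using up_ratios[OF that] f_init[OF that] by (auto simp: min_def split: if_splits)

  have crit0: "(\<exists>a\<in>upstream m. \<theta> \<le> demand_of U0 a / C a) \<and>
      (\<forall>b\<in>downstream m n. f b \<le> supply_of U0 b) \<and>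
      ((\<forall>a\<in>upstream m. demand_of U0 a / C a \<le> \<theta>) \<or>
        (\<exists>b\<in>downstream m n. f b = supply_of U0 b))"
    by (rule iffD1[OF critical_flux_iff[OF f0 split]])
      (simp_all only: \<theta>_def critical_critical_ratio)
  then have served_or_exhausted: "(\<forall>a\<in>upstream m. demand_of U0 a / C a \<le> \<theta>) \<or>
      (\<exists>b\<in>downstream m n. f b = supply_of U0 b)"
    by blast
  obtain a1 where a1: "a1 \<in> upstream m" and "\<theta> \<le> demand_of U0 a1 / C a1"
    using crit0 by blast
  then have flux_a1: "f a1 / C a1 = \<theta>"
    using f0[OF a1] by simp
  \<comment> \<open>A congested link has interior demand ratio one, which exceeds the level; and a downstream
    link that does not receive its whole initial supply has a flux below its interior supply.\<close>
  have alternative: "(\<forall>a\<in>upstream m. demand_of U a / C a \<le> \<theta> \<and> demand_of Us a / C a \<le> \<theta>) \<or>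
      (\<exists>b\<in>downstream m n. f b = supply_of U b \<and> f b = supply_of Us b)"
    using served_or_exhausted
  proof (elim disjE bexE)
    assume served: "\<forall>a\<in>upstream m. demand_of U0 a / C a \<le> \<theta>"
    have "demand_of U a / C a \<le> \<theta> \<and> demand_of Us a / C a \<le> \<theta>" if "a \<in> upstream m" for a
      using up_ratios[OF that] served that f0[OF that] by force
    then show ?thesis
      by blast
  next
    fix b assume b: "b \<in> downstream m n" and "f b = supply_of U0 b"
    then show ?thesis
      using down_cases[OF b] link_statesD(4)[OF U, of b] by force
  qed
  have f_le: "f b \<le> supply_of U b" "f b \<le> supply_of Us b" if "b \<in> downstream m n" for b
    using down_cases[OF that] f_min[of b] that by auto

  show "critical_ratio m n C \<xi> (\<lambda>a. demand_of U a / C a) (\<lambda>b. supply_of U b / C b) = \<theta>"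
  proof (rule critical_ratio_eqI[where f = f, OF f_init split])
    show "\<exists>a\<in>upstream m. \<theta> \<le> demand_of U a / C a"
      using a1 flux_a1 f_init[OF a1] by (intro bexI[of _ a1]) auto
  qed (use alternative f_le in auto)
  show "critical_ratio m n C \<xi> (\<lambda>a. demand_of Us a / C a) (\<lambda>b. supply_of Us b / C b) = \<theta>"
  proof (rule critical_ratio_eqI[where f = f, OF f_stat split])
    show "\<exists>a\<in>upstream m. \<theta> \<le> demand_of Us a / C a"
      using a1 flux_a1 f_stat[OF a1] by (intro bexI[of _ a1]) auto
  qed (use alternative f_le in auto)
  have f_le_\<theta>: "f a / C a \<le> \<theta>" if "a \<in> upstream m" for a
    using f0[OF that] by simp
  show "critical_ratio m n C \<xi> (\<lambda>a. f a / C a) (\<lambda>b. supply_of U b / C b) = \<theta>"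
  proof (rule critical_ratio_eqI[where f = f, OF _ split])
    show "\<exists>a\<in>upstream m. \<theta> \<le> f a / C a"
      using a1 flux_a1 by auto
  qed (use f_le_\<theta> f_le in auto)
qed

lemma riemann_solution_flux:
  assumes "U \<in> link_states m n C" and "riemann_solution m n C \<xi> U Us U0 f"
  shows "f = local_flux m n C \<xi> (junction_data m U)"
proof (rule local_flux_eqI)
  show "f \<in> extensional (links m n)"
    using assms(2) unfolding riemann_solution_def by blast
  show "f a / C a = min (junction_data m U a / C a) (level (junction_data m U))"
    if "a \<in> upstream m" for a
    using riemann_solution_levels(1,5)[OF assms] that
    by (simp add: level_junction_data) (simp add: junction_data_def)
qed (rule riemann_solution_levels(7)[OF assms])

text \<open>The solution keeps a link's initial datum if the flux of the initial data realizes it in full;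
  otherwise the link becomes congested (upstream) or undersaturated (downstream) at that flux.
  Raising the datum to the capacity then changes neither the truncation at the level nor the
  exhausted supplies, so the interior level is the initial one.\<close>

lemma riemann_solution_exists:
  assumes U: "U \<in> link_states m n C"
  shows "\<exists>Us U0 f. riemann_solution m n C \<xi> U Us U0 f"
proof -
  define \<mu> where "\<mu> = (\<lambda>a. demand_of U a / C a)"
  define \<nu> where "\<nu> = (\<lambda>b. supply_of U b / C b)"
  define \<theta> where "\<theta> = critical_ratio m n C \<xi> \<mu> \<nu>"
  define f where "f = local_flux m n C \<xi> (junction_data m U)"
  define V where "V = (\<lambda>a.
    if a \<in> upstream m then if f a = demand_of U a then (demand_of U a, C a) else (C a, f a)
    else if f a = supply_of U a then (C a, supply_of U a) else (f a, C a))"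
  have pos: "0 < C a" if "a \<in> links m n" for a
    using that by (rule capacity_pos)
  have \<theta>_level: "level (junction_data m U) = \<theta>"
    unfolding \<theta>_def \<mu>_def \<nu>_def by (rule level_junction_data)
  have ext: "f \<in> extensional (links m n)"
    unfolding f_def local_flux_def Let_def by simp
  have split: "f b = (\<Sum>a\<in>upstream m. f a * \<xi> a b)" if "b \<in> downstream m n" for b
    unfolding f_def by (rule local_flux_downstream[OF that])
  have flux: "f a / C a = min (\<mu> a) \<theta>" if "a \<in> upstream m" for a
    using local_flux_upstream[OF that, of "junction_data m U"] that
    unfolding \<theta>_level f_def[symmetric] by (simp add: junction_data_def \<mu>_def)
  have "0 \<le> \<theta>"
    unfolding \<theta>_def \<mu>_def \<nu>_def using link_statesD[OF U] pos
    by (intro critical_ratio_nonneg) (auto simp: less_imp_le)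
  have \<mu>_bounds: "0 \<le> \<mu> a" "\<mu> a \<le> 1" if "a \<in> upstream m" for a
    using link_statesD[OF U, of a] pos[of a] that by (auto simp: \<mu>_def)
  have f_up: "0 \<le> f a" "f a \<le> demand_of U a" if "a \<in> upstream m" for a
  proof -
    have "0 \<le> f a / C a" "f a / C a \<le> demand_of U a / C a"
      using flux[OF that] \<mu>_bounds[OF that] \<open>0 \<le> \<theta>\<close> by (auto simp: \<mu>_def)
    then show "0 \<le> f a" "f a \<le> demand_of U a"
      using pos[of a] that by (auto simp: zero_le_divide_iff divide_le_cancel)
  qed
  have crit: "(\<exists>a\<in>upstream m. \<theta> \<le> \<mu> a) \<and> (\<forall>b\<in>downstream m n. f b \<le> supply_of U b) \<and>
      ((\<forall>a\<in>upstream m. \<mu> a \<le> \<theta>) \<or> (\<exists>b\<in>downstream m n. f b = supply_of U b))"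
    by (rule iffD1[OF critical_flux_iff[OF flux split]])
      (simp_all only: \<theta>_def \<nu>_def critical_critical_ratio)
  have f_down: "0 \<le> f b" "f b \<le> supply_of U b" if "b \<in> downstream m n" for b
  proof -
    show "0 \<le> f b"
      unfolding split[OF that] using f_up(1) turning_pos that
      by (intro sum_nonneg mult_nonneg_nonneg) (auto intro: less_imp_le)
    show "f b \<le> supply_of U b"
      using crit that by blast
  qed

  have V_states: "V \<in> link_states m n C"
    unfolding link_states_def mem_Collect_eq
  proof
    fix a assume a: "a \<in> links m n"
    then consider "a \<in> upstream m" | "a \<notin> upstream m" "a \<in> downstream m n"
      by blast
    then show "V a \<in> states (C a)"
      using link_statesD[OF U a] f_up[of a] f_down[of a]
      by cases (auto simp: V_def states_def)
  qed
  have flux_V: "f a / C a = min (demand_of V a / C a) \<theta>" and \<mu>_le: "\<mu> a \<le> demand_of V a / C a"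
    and served: "\<mu> a \<le> \<theta> \<Longrightarrow> demand_of V a / C a \<le> \<theta>"
    if a: "a \<in> upstream m" for a
  proof -
    have C: "0 < C a"
      using pos a by simp
    consider "f a = demand_of U a" "demand_of V a = demand_of U a"
      | "f a \<noteq> demand_of U a" "demand_of V a = C a"
      using a by (auto simp: V_def)
    then have "f a / C a = min (demand_of V a / C a) \<theta> \<and> \<mu> a \<le> demand_of V a / C a \<and>
      (\<mu> a \<le> \<theta> \<longrightarrow> demand_of V a / C a \<le> \<theta>)"
    proof cases
      case 1
      then show ?thesis
        using flux[OF a] by (simp add: \<mu>_def)
    next
      case 2
      have "f a / C a \<noteq> \<mu> a"
        using 2 C by (simp add: \<mu>_def)
      then show ?thesis
        using flux[OF a] 2 C \<mu>_bounds[OF a] by (auto simp: min_def split: if_splits)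
    qed
    then show "f a / C a = min (demand_of V a / C a) \<theta>" "\<mu> a \<le> demand_of V a / C a"
      "\<mu> a \<le> \<theta> \<Longrightarrow> demand_of V a / C a \<le> \<theta>"
      by auto
  qed
  have "critical_ratio m n C \<xi> (\<lambda>a. demand_of V a / C a) (\<lambda>b. supply_of V b / C b) = \<theta>"
  proof (rule critical_ratio_eqI[where f = f, OF flux_V split])
    show "\<exists>a\<in>upstream m. \<theta> \<le> demand_of V a / C a"
      using crit \<mu>_le order_trans by blast
    show "f b \<le> supply_of V b" if "b \<in> downstream m n" for b
      using f_down[OF that] link_statesD(4)[OF U, of b] that by (auto simp: V_def)
    show "(\<forall>a\<in>upstream m. demand_of V a / C a \<le> \<theta>) \<or>
        (\<exists>b\<in>downstream m n. f b = supply_of V b)"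
      using crit
    proof (elim conjE disjE bexE)
      fix b assume b: "b \<in> downstream m n" "f b = supply_of U b"
      then have "f b = supply_of V b"
        by (auto simp: V_def)
      with b show ?thesis
        by blast
    qed (use served in blast)
  qed
  then have "level (junction_data m V) = \<theta>"
    by (simp add: level_junction_data)
  then have "f = local_flux m n C \<xi> (junction_data m V)"
    using flux_V by (intro local_flux_eqI[OF ext _ split]) (auto simp: junction_data_def)
  moreover have "f a = min (demand_of V a) (supply_of V a)" if "a \<in> links m n" for a
    using that f_up[of a] f_down[of a] link_statesD[OF U that] by (auto simp: V_def)
  moreover have "V a \<in> {(demand_of U a, C a)} \<union> {(C a, s) | s. s < demand_of U a}"
    if "a \<in> upstream m" for a
    using that f_up[of a] by (auto simp: V_def)
  moreover have "V b \<in> {(C b, supply_of U b)} \<union> {(d, C b) | d. d < supply_of U b}"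
    if "b \<in> downstream m n" for b
    using that f_down[of b] by (auto simp: V_def)
  ultimately have "riemann_solution m n C \<xi> U V V f"
    unfolding riemann_solution_def using V_states ext by auto
  then show ?thesis
    by blast
qed

lemma riemann_flux_iff:
  assumes "\<forall>a\<in>links m n. 0 \<le> z a \<and> z a \<le> C a"
  shows "riemann_flux m n C \<xi> z f \<longleftrightarrow> f = local_flux m n C \<xi> z"
proof -
  have flux: "f = local_flux m n C \<xi> z"
    if "U \<in> link_states m n C" "\<forall>a\<in>links m n. junction_data m U a = z a"
      "riemann_solution m n C \<xi> U Us U0 f" for U Us U0 f
  proof -
    have f: "f = local_flux m n C \<xi> (junction_data m U)"
      using riemann_solution_flux that by blast
    have "level (junction_data m U) = level z"
      using that(2) by (intro critical_ratio_cong) auto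
    then show ?thesis
      using that(2) local_flux_upstream[of _ "junction_data m U"]
        local_flux_downstream[of _ "junction_data m U"]
      unfolding f by (intro local_flux_eqI) (auto simp: local_flux_def[of m n C \<xi>] Let_def)
  qed
  define U where "U = (\<lambda>a. if a \<in> upstream m then (z a, C a) else (C a, z a))"
  have U: "U \<in> link_states m n C"
    using assms capacity_pos by (force simp: U_def link_states_def states_def)
  have data: "\<forall>a\<in>links m n. junction_data m U a = z a"
    by (simp add: U_def junction_data_def)
  obtain Us U0 g where g: "riemann_solution m n C \<xi> U Us U0 g"
    using riemann_solution_exists[OF U] by blast
  then have "riemann_flux m n C \<xi> z (local_flux m n C \<xi> z)"
    unfolding riemann_flux_def using flux[OF U data g] U data by blast
  then show ?thesis
    using flux unfolding riemann_flux_def by blast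
qed

end

theorem theorem4p3:
  fixes m n :: nat and C :: "nat \<Rightarrow> real" and \<xi> :: "nat \<Rightarrow> nat \<Rightarrow> real"
  assumes "m \<ge> 1" and "n \<ge> 1"
    and "\<And>a. a \<in> links m n \<Longrightarrow> C a > 0"
    and "\<And>a b. a \<in> upstream m \<Longrightarrow> b \<in> downstream m n \<Longrightarrow> 0 < \<xi> a b \<and> \<xi> a b \<le> 1"
    and "\<And>a. a \<in> upstream m \<Longrightarrow> (\<Sum>b\<in>downstream m n. \<xi> a b) = 1"
  shows
    "(\<forall>U Us U0 f. U \<in> link_states m n C \<and> riemann_solution m n C \<xi> U Us U0 f \<longrightarrow>
        (let \<delta> = (\<lambda>a. demand_of U a / C a); \<delta>s = (\<lambda>a. demand_of Us a / C a);
             \<delta>0 = (\<lambda>a. demand_of U0 a / C a); \<delta>t = (\<lambda>a. f a / C a);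
             \<sigma> = (\<lambda>b. supply_of U b / C b); \<sigma>s = (\<lambda>b. supply_of Us b / C b);
             \<sigma>0 = (\<lambda>b. supply_of U0 b / C b);
             \<theta>0 = critical_ratio m n C \<xi> \<delta>0 \<sigma>0; \<theta> = critical_ratio m n C \<xi> \<delta> \<sigma>;
             \<theta>s = critical_ratio m n C \<xi> \<delta>s \<sigma>s; \<theta>t = critical_ratio m n C \<xi> \<delta>t \<sigma>
         in \<theta>0 = \<theta> \<and> \<theta> = \<theta>s \<and> \<theta>s = \<theta>t \<and>
            (\<forall>a\<in>upstream m.
               \<delta>t a = min (\<delta> a) \<theta> \<and> \<delta>t a = min (\<delta>0 a) \<theta>0 \<and>
               \<delta>t a = min (\<delta>s a) \<theta>s \<and> \<delta>t a = min (\<delta> a) \<theta>t)))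
     \<and> (\<forall>U. U \<in> link_states m n C \<longrightarrow> (\<exists>Us U0 f. riemann_solution m n C \<xi> U Us U0 f))
     \<and> (\<forall>z. (\<forall>a\<in>links m n. 0 \<le> z a \<and> z a \<le> C a) \<longrightarrow>
          (\<exists>!f. riemann_flux m n C \<xi> z f) \<and>
          global_flux m n C \<xi> z = local_flux m n C \<xi> z)"
proof -
  interpret junction m n C \<xi>
    using assms by unfold_locales auto
  show ?thesis
  proof (intro conjI allI impI, goal_cases)
    case (1 U Us U0 f)
    then have "U \<in> link_states m n C" "riemann_solution m n C \<xi> U Us U0 f"
      by auto
    note levels = riemann_solution_levels[OF this]
    show ?case
      unfolding Let_def levels(1-3) using levels(4-6) by simp
  next
    case (2 U)
    then show ?case
      by (rule riemann_solution_exists)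
  next
    case (3 z)
    then show ?case
      by (simp add: riemann_flux_iff)
  next
    case (4 z)
    then show ?case
      by (simp add: global_flux_def riemann_flux_iff)
  qed
qed

end
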